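(* Let $(X,b,m)$ be a connected weighted graph with $\mathrm{vol}(X)<\infty$ and $\mathrm{diam}(X)<\infty$. Then $$\lambda_1^N(X)\ \ge\ \frac{4}{\mathrm{diam}(X)\,\mathrm{vol}(X)} .$$
   Context: A weighted graph is a triple $(X,b,m)$ where $X$ is a non-empty set (of vertices), $b:X\times X\to[0,\infty)$ is symmetric with $b(x,x)=0$ for all $x\in X$, and $m:X\to(0,\infty)$ is a function. No local finiteness or summability of $b$ is assumed. Put $\mathrm{vol}(X)=\sum_{x\in X}m(x)\in(0,\infty]$. A path from $x$ to $y$ is a finite sequence $\gamma=(x_0,\dots,x_k)$ in $X$ with $x_0=x$, $x_k=y$ and $b(x_l,x_{l+1})>0$ for $l=0,\dots,k-1$; its length is $L(\gamma)=\sum_{j=0}^{k-1}\frac{1}{b(x_j,x_{j+1})}$. The graph is connected if any two vertices are joined by a path. The pseudo-metric $d$ is $d(x,y)=\inf\{L(\gamma)\mid\gamma\text{ a path from }x\text{ to }y\}$ with $d(x,x)=0$ (it need not separate points), and $\mathrm{diam}(X)=\sup\{d(x,y)\mid x,y\in X\}$. The energy is $\mathcal{E}(f)=\frac12\sum_{x,y\in X}b(x,y)(f(x)-f(y))^2\in[0,\infty]$ for $f:X\to\mathbb{R}$. The Hilbert space $\ell^2(X,m)$ consists of $f:X\to\mathbb{R}$ with $\sum_{x}f(x)^2m(x)<\infty$, with inner product $\langle f,g\rangle=\sum_x f(x)g(x)m(x)$ and norm $\|f\|=\sqrt{\langle f,f\rangle}$. Define $$\lambda_1^N(X)=\inf\{\mathcal{E}(f)\mid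 f\in\ell^2(X,m),\ \mathcal{E}(f)<\infty,\ \langle f,1\rangle=0,\ \|f\|=1\},$$ with $\inf\emptyset=\infty$. The convention $1/0=\infty$ (also $4/0=\infty$) is used. *)

theory Defs
  imports "HOL-Analysis.Analysis"
begin

text \<open>
  The weights are real-valued functions on the ambient type, of which only the values on the
  vertex set \<open>X\<close> (respectively \<open>X \<times> X\<close>) are used. Quantities that may be infinite are of type
  \<^typ>\<open>ennreal\<close>, where every family is summable, \<open>Inf {} = top\<close> and \<open>4 / 0 = top\<close>.
\<close>

locale weighted_graph =
  fixes X :: "'a set" and b :: "'a \<Rightarrow> 'a \<Rightarrow> real" and m :: "'a \<Rightarrow> real"
  assumes nonempty: "X \<noteq> {}"
    and b_nonneg: "\<And>x y. x \<in> X \<Longrightarrow> y \<in> X \<Longrightarrow> 0 \<le> b x y"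
    and b_sym: "\<And>x y. x \<in> X \<Longrightarrow> y \<in> X \<Longrightarrow> b x y = b y x"
    and b_diag: "\<And>x. x \<in> X \<Longrightarrow> b x x = 0"
    and m_pos: "\<And>x. x \<in> X \<Longrightarrow> 0 < m x"

definition vol :: "'a set \<Rightarrow> ('a \<Rightarrow> real) \<Rightarrow> ennreal" where
  "vol X m = (\<Sum>\<^sub>\<infinity>x\<in>X. ennreal (m x))"

text \<open>A path \<open>(x\<^sub>0, \<dots>, x\<^sub>k)\<close> is the list of its \<open>k + 1\<close> vertices; \<open>k = 0\<close> is allowed.\<close>

definition graph_path :: "'a set \<Rightarrow> ('a \<Rightarrow> 'a \<Rightarrow> real) \<Rightarrow> 'a \<Rightarrow> 'a \<Rightarrow> 'a list \<Rightarrow> bool" where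
  "graph_path X b x y p \<longleftrightarrow>
     p \<noteq> [] \<and> set p \<subseteq> X \<and> hd p = x \<and> last p = y \<and>
     (\<forall>l < length p - 1. b (p ! l) (p ! Suc l) > 0)"

definition path_len :: "('a \<Rightarrow> 'a \<Rightarrow> real) \<Rightarrow> 'a list \<Rightarrow> real" where
  "path_len b p = (\<Sum>j < length p - 1. 1 / b (p ! j) (p ! Suc j))"

definition graph_connected :: "'a set \<Rightarrow> ('a \<Rightarrow> 'a \<Rightarrow> real) \<Rightarrow> bool" where
  "graph_connected X b \<longleftrightarrow> (\<forall>x\<in>X. \<forall>y\<in>X. \<exists>p. graph_path X b x y p)"

definition graph_dist :: "'a set \<Rightarrow> ('a \<Rightarrow> 'a \<Rightarrow> real) \<Rightarrow> 'a \<Rightarrow> 'a \<Rightarrow> ennreal" where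
  "graph_dist X b x y = Inf {ennreal (path_len b p) | p. graph_path X b x y p}"

text \<open>The convention \<open>d x x = 0\<close> is a consequence of admitting the path with a single vertex.\<close>

lemma graph_dist_self:
  assumes "x \<in> X"
  shows "graph_dist X b x x = 0"
proof -
  have "graph_path X b x x [x]" "path_len b [x] = 0"
    using assms by (auto simp: graph_path_def path_len_def)
  then have "graph_dist X b x x \<le> ennreal 0"
    unfolding graph_dist_def by (intro Inf_lower) force
  then show ?thesis by simp
qed

definition graph_diam :: "'a set \<Rightarrow> ('a \<Rightarrow> 'a \<Rightarrow> real) \<Rightarrow> ennreal" where
  "graph_diam X b = Sup {graph_dist X b x y | x y. x \<in> X \<and> y \<in> X}"

definition energy :: "'a set \<Rightarrow> ('a \<Rightarrow> 'a \<Rightarrow> real) \<Rightarrow> ('a \<Rightarrow> real) \<Rightarrow> ennreal" where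
  "energy X b f = (1 / 2) * (\<Sum>\<^sub>\<infinity>(x, y)\<in>X \<times> X. ennreal (b x y * (f x - f y)\<^sup>2))"

definition l2 :: "'a set \<Rightarrow> ('a \<Rightarrow> real) \<Rightarrow> ('a \<Rightarrow> real) set" where
  "l2 X m = {f. (\<lambda>x. (f x)\<^sup>2 * m x) summable_on X}"

definition l2_inner :: "'a set \<Rightarrow> ('a \<Rightarrow> real) \<Rightarrow> ('a \<Rightarrow> real) \<Rightarrow> ('a \<Rightarrow> real) \<Rightarrow> real" where
  "l2_inner X m f g = (\<Sum>\<^sub>\<infinity>x\<in>X. f x * g x * m x)"

definition l2_norm :: "'a set \<Rightarrow> ('a \<Rightarrow> real) \<Rightarrow> ('a \<Rightarrow> real) \<Rightarrow> real" where
  "l2_norm X m f = sqrt (l2_inner X m f f)"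

text \<open>
  The function \<open>1\<close> lies in \<open>l2 X m\<close> exactly when \<open>vol X m < top\<close>; the pairing with it below is an
  inner product of two elements of \<open>l2 X m\<close> only in that case.
\<close>

definition lambda1N :: "'a set \<Rightarrow> ('a \<Rightarrow> 'a \<Rightarrow> real) \<Rightarrow> ('a \<Rightarrow> real) \<Rightarrow> ennreal" where
  "lambda1N X b m =
     Inf {energy X b f | f. f \<in> l2 X m \<and> energy X b f < top \<and>
                            l2_inner X m f (\<lambda>_. 1) = 0 \<and> l2_norm X m f = 1}"

end

theory Submission
  imports Defs
begin

text \<open>
  Two inequalities carry the bound. The first controls the oscillation of a function by its
  energy: along a path, Cauchy--Schwarz with the weights \<open>1 / b\<close> and \<open>b\<close> on the edges gives
  \<open>(f x - f y)\<^sup>2 \<le> path_len b p * S\<close>, where \<open>S\<close> sums \<open>b u v * (f u - f v)\<^sup>2\<close> over the edges of the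
  path. If the path visits no vertex twice, its edges are pairwise distinct as unordered pairs,
  and the factor \<open>1 / 2\<close> in the energy counts each unordered pair once; hence \<open>S\<close> is at most the
  energy (\<open>sum_edges_le_energy\<close>). Cutting out loops only shortens a path
  (\<open>exists_distinct_path\<close>), so taking the infimum over all paths yields
  \<open>(f x - f y)\<^sup>2 \<le> diam * energy\<close> (\<open>oscillation_le\<close>).

  The second is Popoviciu's inequality (\<open>popoviciu\<close>): a function with mean zero whose
  oscillation is at most \<open>s\<close> satisfies \<open>\<parallel>f\<parallel>\<^sup>2 \<le> s\<^sup>2 / 4 * vol\<close>. With \<open>s\<^sup>2 = diam * energy\<close> and
  \<open>\<parallel>f\<parallel> = 1\<close> this is \<open>4 \<le> diam * vol * energy\<close>. In particular no admissible \<open>f\<close> exists when the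
  diameter is zero, which matches the conventions \<open>Inf {} = top\<close> and \<open>4 / 0 = top\<close>.
\<close>

section \<open>Paths without repeated vertices\<close>

lemma graph_path_Cons:
  assumes "q \<noteq> []"
  shows "graph_path X b x y (v # q) \<longleftrightarrow>
    v = x \<and> x \<in> X \<and> 0 < b x (hd q) \<and> graph_path X b (hd q) y q"
proof -
  obtain n where n: "length q = Suc n" using assms by (cases q) auto
  have "(\<forall>l < length (v # q) - 1. b ((v # q) ! l) ((v # q) ! Suc l) > 0) \<longleftrightarrow>
      0 < b v (hd q) \<and> (\<forall>l < length q - 1. b (q ! l) (q ! Suc l) > 0)"
    using assms by (simp add: n All_less_Suc2 hd_conv_nth)
  then show ?thesis using assms unfolding graph_path_def by auto
qed

lemma path_len_Cons:
  assumes "q \<noteq> []"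
  shows "path_len b (v # q) = 1 / b v (hd q) + path_len b q"
proof -
  obtain n where n: "length q = Suc n" using assms by (cases q) auto
  show ?thesis
    using assms unfolding path_len_def
    by (simp add: n sum.lessThan_Suc_shift hd_conv_nth del: sum.lessThan_Suc)
qed

lemma path_len_nonneg:
  assumes "graph_path X b x y p"
  shows "0 \<le> path_len b p"
  using assms unfolding graph_path_def path_len_def
  by (intro sum_nonneg) (auto simp: less_imp_le)

lemma graph_path_suffix:
  assumes "graph_path X b z y (us @ x # vs)"
  shows "graph_path X b x y (x # vs) \<and> path_len b (x # vs) \<le> path_len b (us @ x # vs)"
  using assms
proof (induction us arbitrary: z)
  case Nil
  then show ?case by (auto simp: graph_path_def)
next
  case (Cons u us)
  let ?q = "us @ x # vs"
  have *: "0 < b u (hd ?q)" "graph_path X b (hd ?q) y ?q"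
    using Cons.prems by (auto simp: graph_path_Cons)
  have "path_len b ?q \<le> path_len b (u # ?q)"
    using *(1) by (simp add: path_len_Cons)
  with Cons.IH[OF *(2)] show ?case by auto
qed

text \<open>
  A new first vertex \<open>x\<close> either extends a repetition-free path or already lies on it; in the
  latter case the part of the path from \<open>x\<close> on serves.
\<close>

lemma exists_distinct_path:
  assumes "graph_path X b x y p"
  shows "\<exists>q. graph_path X b x y q \<and> distinct q \<and> path_len b q \<le> path_len b p"
  using assms
proof (induction p arbitrary: x)
  case Nil
  then show ?case by (simp add: graph_path_def)
next
  case (Cons v r)
  show ?case
  proof (cases "r = []")
    case True
    then show ?thesis using Cons.prems by (intro exI[of _ "v # r"]) auto
  next
    case False
    then have r: "v = x" "x \<in> X" "0 < b x (hd r)" "graph_path X b (hd r) y r"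
      using Cons.prems by (auto simp: graph_path_Cons)
    from Cons.IH[OF r(4)] obtain q where
      q: "graph_path X b (hd r) y q" "distinct q" "path_len b q \<le> path_len b r"
      by blast
    have hd_q: "q \<noteq> []" "hd q = hd r" using q(1) by (auto simp: graph_path_def)
    have len: "path_len b (v # r) = 1 / b x (hd r) + path_len b r"
      using False r(1) by (simp add: path_len_Cons)
    show ?thesis
    proof (cases "x \<in> set q")
      case True
      then obtain us vs where split: "q = us @ x # vs" by (meson split_list)
      have "graph_path X b x y (x # vs)" "path_len b (x # vs) \<le> path_len b q"
        using graph_path_suffix[OF q(1)[unfolded split]] by (auto simp: split)
      moreover have "distinct (x # vs)" using q(2) split by simp
      moreover have "path_len b q \<le> path_len b (v # r)"
        using q(3) r(3) unfolding len by (simp add: add_increasing)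
      ultimately show ?thesis by (meson order_trans)
    next
      case False
      have "graph_path X b x y (x # q)" using r q(1) hd_q by (simp add: graph_path_Cons)
      moreover have "path_len b (x # q) \<le> path_len b (v # r)"
        unfolding len using q(3) hd_q by (simp add: path_len_Cons)
      ultimately show ?thesis using False q(2) by (intro exI[of _ "x # q"]) auto
    qed
  qed
qed

section \<open>Energy and oscillation\<close>

lemma sum_le_infsum_ennreal:
  fixes g :: "'b \<Rightarrow> ennreal"
  assumes "finite F" "F \<subseteq> A"
  shows "sum g F \<le> infsum g A"
proof -
  have "infsum g F \<le> infsum g A"
    using assms(2) by (intro infsum_mono_neutral nonneg_summable_on_complete) auto
  then show ?thesis using assms(1) by simp
qed

text \<open>
  Each edge of the path occurs in the double sum of the energy in both orientations. Since no
  vertex is repeated, no edge is traversed twice, in the same or in the opposite direction.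
\<close>

lemma sum_edges_le_energy:
  assumes wg: "weighted_graph X b m"
    and path: "graph_path X b x y p" and dist: "distinct p"
  shows "ennreal (\<Sum>j < length p - 1. b (p ! j) (p ! Suc j) * (f (p ! j) - f (p ! Suc j))\<^sup>2)
    \<le> energy X b f"
proof -
  define n where "n = length p - 1"
  define F where "F = (\<lambda>(x, y). b x y * (f x - f y)\<^sup>2)"
  define e where "e = (\<lambda>j. (p ! j, p ! Suc j))"
  define e' where "e' = (\<lambda>j. (p ! Suc j, p ! j))"
  let ?S = "\<Sum>j<n. F (e j)"
  have in_X: "p ! j \<in> X" if "j \<le> n" for j
    using path that unfolding graph_path_def n_def
    by (metis Suc_pred' le_imp_less_Suc length_greater_0_conv nth_mem subsetD)
  have inj_p: "p ! i = p ! j \<longleftrightarrow> i = j" if "i \<le> n" "j \<le> n" for i j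
    using path dist that unfolding graph_path_def n_def
    by (intro nth_eq_iff_index_eq) (auto simp: Suc_le_eq neq_Nil_conv)
  have inj: "inj_on e {..<n}" "inj_on e' {..<n}"
    by (auto simp: inj_on_def e_def e'_def inj_p)
  have disj: "e ` {..<n} \<inter> e' ` {..<n} = {}"
    by (auto simp: e_def e'_def inj_p)
  have sub: "e ` {..<n} \<union> e' ` {..<n} \<subseteq> X \<times> X"
    using in_X by (auto simp: e_def e'_def)
  have F_nonneg: "0 \<le> F z" if "z \<in> X \<times> X" for z
    using that weighted_graph.b_nonneg[OF wg] by (auto simp: F_def)
  have swap: "F (e' j) = F (e j)" if "j < n" for j
    using that in_X weighted_graph.b_sym[OF wg, of "p ! j" "p ! Suc j"]
    by (simp add: F_def e_def e'_def power2_commute)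
  have "2 * ?S = ?S + (\<Sum>j<n. F (e' j))" by (simp add: swap)
  also have "\<dots> = sum F (e ` {..<n}) + sum F (e' ` {..<n})"
    by (simp add: sum.reindex inj)
  also have "\<dots> = sum F (e ` {..<n} \<union> e' ` {..<n})"
    using disj by (simp add: sum.union_disjoint)
  finally have "ennreal (2 * ?S) = (\<Sum>z \<in> e ` {..<n} \<union> e' ` {..<n}. ennreal (F z))"
    using sub F_nonneg by (subst sum_ennreal) auto
  also have "\<dots> \<le> (\<Sum>\<^sub>\<infinity>z\<in>X \<times> X. ennreal (F z))"
    using sub by (intro sum_le_infsum_ennreal) auto
  also have "\<dots> = (\<Sum>\<^sub>\<infinity>(x, y)\<in>X \<times> X. ennreal (b x y * (f x - f y)\<^sup>2))"
    by (simp add: F_def case_prod_unfold)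
  finally have "(1 / 2) * ennreal (2 * ?S) \<le> energy X b f"
    unfolding energy_def by (rule mult_left_mono) simp
  moreover have "(1 / 2) * ennreal (2 * ?S) = ennreal ?S"
  proof -
    have S: "0 \<le> ?S" using sub F_nonneg by (intro sum_nonneg) auto
    have half: "(1 / 2 :: ennreal) = ennreal (1 / 2)"
      using divide_ennreal[of 1 2]
      by (metis ennreal_1 ennreal_numeral zero_le_numeral zero_le_one zero_less_numeral)
    show ?thesis unfolding half using S by (subst ennreal_mult'[symmetric]) simp_all
  qed
  ultimately show ?thesis by (simp add: n_def F_def e_def)
qed

lemma power2_diff_le_path_len_mult:
  assumes wg: "weighted_graph X b m" and path: "graph_path X b x y p"
    and E: "energy X b f = ennreal E" "0 \<le> E"
  shows "(f x - f y)\<^sup>2 \<le> path_len b p * E"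
proof -
  from exists_distinct_path[OF path] obtain q where
    q: "graph_path X b x y q" "distinct q" "path_len b q \<le> path_len b p" by blast
  define n where "n = length q - 1"
  define w where "w = (\<lambda>j. b (q ! j) (q ! Suc j))"
  define D where "D = (\<lambda>j. f (q ! j) - f (q ! Suc j))"
  have w_pos: "0 < w j" if "j < n" for j
    using q(1) that by (auto simp: graph_path_def w_def n_def)
  have "q ! 0 = x" "q ! n = y"
    using q(1) by (metis graph_path_def hd_conv_nth, metis graph_path_def last_conv_nth n_def)
  then have "f x - f y = (\<Sum>j<n. D j)"
    using sum_lessThan_telescope'[of "\<lambda>j. f (q ! j)" n] by (simp add: D_def)
  also have "\<dots> = (\<Sum>j<n. (1 / sqrt (w j)) * (sqrt (w j) * D j))"
    using w_pos by (intro sum.cong) (auto simp: less_imp_neq[symmetric])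
  finally have "(f x - f y)\<^sup>2 \<le> (\<Sum>j<n. (1 / sqrt (w j))\<^sup>2) * (\<Sum>j<n. (sqrt (w j) * D j)\<^sup>2)"
    by (simp only: Cauchy_Schwarz_ineq_sum)
  also have "(\<Sum>j<n. (1 / sqrt (w j))\<^sup>2) = path_len b q"
    unfolding path_len_def n_def[symmetric]
    using w_pos by (intro sum.cong) (auto simp: power_divide w_def less_imp_le)
  also have "(\<Sum>j<n. (sqrt (w j) * D j)\<^sup>2) = (\<Sum>j<n. w j * (D j)\<^sup>2)"
    using w_pos by (intro sum.cong) (auto simp: power_mult_distrib less_imp_le)
  also have "path_len b q * \<dots> \<le> path_len b p * E"
  proof (rule mult_mono)
    show "(\<Sum>j<n. w j * (D j)\<^sup>2) \<le> E"
      using sum_edges_le_energy[OF wg q(1,2), of f] E by (simp add: w_def D_def n_def)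
    show "0 \<le> (\<Sum>j<n. w j * (D j)\<^sup>2)" using w_pos by (intro sum_nonneg) (auto simp: less_imp_le)
  qed (use q(3) path_len_nonneg[OF path] in auto)
  finally show ?thesis .
qed

text \<open>
  For positive energy, dividing by it bounds every path length from below, and hence the
  infimum; for zero energy a single path already forces \<open>f x = f y\<close>.
\<close>

lemma oscillation_le:
  assumes wg: "weighted_graph X b m" and conn: "graph_connected X b"
    and diam: "graph_diam X b = ennreal D" "0 \<le> D"
    and E: "energy X b f = ennreal E" "0 \<le> E"
    and xy: "x \<in> X" "y \<in> X"
  shows "(f x - f y)\<^sup>2 \<le> D * E"
proof (cases "E = 0")
  case True
  obtain p where "graph_path X b x y p" using conn xy by (auto simp: graph_connected_def)
  from power2_diff_le_path_len_mult[OF wg this E] True show ?thesis by simp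
next
  case False
  with E(2) have "0 < E" by simp
  have "ennreal ((f x - f y)\<^sup>2 / E) \<le> graph_dist X b x y"
    unfolding graph_dist_def
  proof (rule Inf_greatest, clarify)
    fix p assume "graph_path X b x y p"
    from power2_diff_le_path_len_mult[OF wg this E] \<open>0 < E\<close>
    show "ennreal ((f x - f y)\<^sup>2 / E) \<le> ennreal (path_len b p)"
      by (intro ennreal_leI) (simp add: pos_divide_le_eq)
  qed
  also have "\<dots> \<le> ennreal D"
    unfolding diam(1)[symmetric] graph_diam_def using xy by (intro Sup_upper) blast
  finally show ?thesis using \<open>0 < E\<close> diam(2) by (simp add: pos_divide_le_eq)
qed

section \<open>Popoviciu's inequality\<close>

text \<open>
  With \<open>u\<close> and \<open>l\<close> the supremum and infimum of \<open>f\<close>, the sum of the non-negative terms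
  \<open>(u - f x) * (f x - l) * m x\<close> is \<open>- N - u * l * V\<close>, as the terms linear in \<open>f\<close> sum to zero;
  and \<open>- u * l \<le> (u - l)\<^sup>2 / 4\<close>.
\<close>

lemma popoviciu:
  fixes f m :: "'a \<Rightarrow> real"
  assumes "X \<noteq> {}" and m_nonneg: "\<And>x. x \<in> X \<Longrightarrow> 0 \<le> m x"
    and V: "(m has_sum V) X"
    and mean: "((\<lambda>x. f x * m x) has_sum 0) X"
    and N: "((\<lambda>x. (f x)\<^sup>2 * m x) has_sum N) X"
    and osc: "\<And>x y. x \<in> X \<Longrightarrow> y \<in> X \<Longrightarrow> f x - f y \<le> s"
  shows "4 * N \<le> s\<^sup>2 * V"
proof -
  define u where "u = (SUP x\<in>X. f x)"
  define l where "l = (INF x\<in>X. f x)"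
  obtain x0 where x0: "x0 \<in> X" using assms(1) by blast
  have bdd: "bdd_above (f ` X)" "bdd_below (f ` X)"
    using osc[OF _ x0] osc[OF x0]
    by (force intro!: bdd_aboveI2[of _ _ "f x0 + s"] bdd_belowI2[of _ "f x0 - s"]
        simp: algebra_simps)+
  have bounds: "f x \<le> u" "l \<le> f x" if "x \<in> X" for x
    unfolding u_def l_def using that bdd by (auto intro: cSUP_upper cINF_lower)
  have "u \<le> f y + s" if "y \<in> X" for y
    unfolding u_def using osc[OF _ that] assms(1) by (intro cSUP_least) (auto simp: algebra_simps)
  then have "u - s \<le> l"
    unfolding l_def using assms(1) by (intro cINF_greatest) (auto simp: algebra_simps)
  moreover have "l \<le> u" using bounds[OF x0] by linarith
  ultimately have width: "(u - l)\<^sup>2 \<le> s\<^sup>2" by (intro power_mono) auto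
  have "((\<lambda>x. ((u + l) * (f x * m x) + (- 1) * ((f x)\<^sup>2 * m x)) + (- (u * l)) * m x) has_sum
      ((u + l) * 0 + (- 1) * N) + (- (u * l)) * V) X"
    by (intro has_sum_add has_sum_cmult_right V mean N)
  also have "(\<lambda>x. ((u + l) * (f x * m x) + (- 1) * ((f x)\<^sup>2 * m x)) + (- (u * l)) * m x)
      = (\<lambda>x. (u - f x) * (f x - l) * m x)"
    by (simp add: algebra_simps power2_eq_square)
  finally have "0 \<le> ((u + l) * 0 + (- 1) * N) + (- (u * l)) * V"
    using bounds m_nonneg by (elim has_sum_nonneg) auto
  then have "4 * N \<le> (- 4 * u * l) * V" by (simp add: mult_ac)
  also have "\<dots> \<le> (u - l)\<^sup>2 * V"
  proof (rule mult_right_mono)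
    show "- 4 * u * l \<le> (u - l)\<^sup>2"
      using zero_le_power2[of "u + l"] by (simp add: power2_eq_square algebra_simps)
    show "0 \<le> V" using V m_nonneg by (rule has_sum_nonneg)
  qed
  also have "\<dots> \<le> s\<^sup>2 * V"
    using width has_sum_nonneg[OF V m_nonneg] by (rule mult_right_mono)
  finally show ?thesis .
qed

section \<open>The spectral bound\<close>

text \<open>
  This transfers the volume from extended to real summation, where the signed sums of
  Popoviciu's inequality live.
\<close>

lemma has_sum_of_vol:
  assumes m_nonneg: "\<And>x. x \<in> X \<Longrightarrow> 0 \<le> m x" and vol: "vol X m = ennreal V" "0 \<le> V"
  shows "(m has_sum V) X"
proof -
  have bound: "sum m F \<le> V" if "finite F" "F \<subseteq> X" for F
  proof -
    have "ennreal (sum m F) = (\<Sum>x\<in>F. ennreal (m x))"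
      using that m_nonneg by (subst sum_ennreal) auto
    also have "\<dots> \<le> vol X m"
      unfolding vol_def using that
      by (intro sum_le_infsum_ennreal)
    finally show ?thesis using vol by simp
  qed
  have summable: "m summable_on X"
    using m_nonneg bound
    by (intro nonneg_bdd_above_summable_on) (auto intro!: bdd_aboveI2)
  have "((\<lambda>x. ennreal (m x)) has_sum ennreal (infsum m X)) X"
  proof -
    have "((\<lambda>F. ennreal (sum m F)) \<longlongrightarrow> ennreal (infsum m X)) (finite_subsets_at_top X)"
      using has_sum_infsum[OF summable] unfolding has_sum_def by (rule tendsto_ennrealI)
    moreover have "\<forall>\<^sub>F F in finite_subsets_at_top X. ennreal (sum m F) = (\<Sum>x\<in>F. ennreal (m x))"
      using m_nonneg by (intro eventually_finite_subsets_at_top_weakI) (auto simp: subset_iff)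
    ultimately show ?thesis
      unfolding has_sum_def by (rule Lim_transform_eventually)
  qed
  then have "ennreal (infsum m X) = ennreal V"
    using vol(1) unfolding vol_def by (simp add: infsumI)
  then have "infsum m X = V"
    using vol(2) m_nonneg by (simp add: infsum_nonneg)
  then show ?thesis using has_sum_infsum[OF summable] by simp
qed

theorem theorem3p4:
  fixes X :: "'a set" and b :: "'a \<Rightarrow> 'a \<Rightarrow> real" and m :: "'a \<Rightarrow> real"
  assumes "weighted_graph X b m"
    and "graph_connected X b"
    and "vol X m < top"
    and "graph_diam X b < top"
  shows "lambda1N X b m \<ge> 4 / (graph_diam X b * vol X m)"
  unfolding lambda1N_def
proof (rule Inf_greatest, clarify)
  fix f
  assume l2: "f \<in> l2 X m" and fin: "energy X b f < top"
    and mean: "l2_inner X m f (\<lambda>_. 1) = 0" and norm: "l2_norm X m f = 1"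
  have m_nonneg: "0 \<le> m x" if "x \<in> X" for x
    using weighted_graph.m_pos[OF assms(1) that] by simp
  obtain V where V: "vol X m = ennreal V" "0 \<le> V"
    using assms(3) by (cases "vol X m") auto
  obtain D where D: "graph_diam X b = ennreal D" "0 \<le> D"
    using assms(4) by (cases "graph_diam X b") auto
  obtain E where E: "energy X b f = ennreal E" "0 \<le> E"
    using fin by (cases "energy X b f") auto
  have m_sum: "(m has_sum V) X" using m_nonneg V by (rule has_sum_of_vol)
  have osc: "\<bar>f x - f y\<bar> \<le> sqrt (D * E)" if "x \<in> X" "y \<in> X" for x y
    using oscillation_le[OF assms(1,2) D E that] by (rule real_le_rsqrt[OF order_trans[rotated]]) simp
  obtain x0 where x0: "x0 \<in> X" using weighted_graph.nonempty[OF assms(1)] by blast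
  \<comment> \<open>Finite oscillation makes \<open>f\<close> bounded, so it is integrable for the finite measure \<open>m\<close>; only
    then does the vanishing of its infinite sum say that the mean is zero.\<close>
  have "(\<lambda>x. f x * m x) summable_on X"
  proof (rule abs_summable_summable, rule summable_on_comparison_test)
    show "(\<lambda>x. (\<bar>f x0\<bar> + sqrt (D * E)) * m x) summable_on X"
      using m_sum by (intro summable_on_cmult_right has_sum_imp_summable)
    show "norm (f x * m x) \<le> (\<bar>f x0\<bar> + sqrt (D * E)) * m x" if "x \<in> X" for x
    proof -
      have "\<bar>f x\<bar> \<le> \<bar>f x0\<bar> + sqrt (D * E)" using osc[OF that x0] by linarith
      then show ?thesis using m_nonneg[OF that] by (simp add: abs_mult mult_right_mono)
    qed
  qed auto
  from has_sum_infsum[OF this] have f_sum: "((\<lambda>x. f x * m x) has_sum 0) X"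
    using mean by (simp add: l2_inner_def)
  have "(\<Sum>\<^sub>\<infinity>x\<in>X. (f x)\<^sup>2 * m x) = 1"
    using norm by (simp add: l2_norm_def l2_inner_def power2_eq_square)
  moreover have "(\<lambda>x. (f x)\<^sup>2 * m x) summable_on X" using l2 by (simp add: l2_def)
  ultimately have f2_sum: "((\<lambda>x. (f x)\<^sup>2 * m x) has_sum 1) X"
    by (metis has_sum_infsum)
  have "4 * 1 \<le> (sqrt (D * E))\<^sup>2 * V"
    by (rule popoviciu[OF weighted_graph.nonempty[OF assms(1)] m_nonneg m_sum f_sum f2_sum])
      (use osc in \<open>auto simp: abs_le_iff\<close>)
  then have main: "4 \<le> D * V * E" using D(2) E(2) by (simp add: mult_ac)
  then have pos: "0 < D * V"
    using D(2) V(2) by (cases "D * V = 0") auto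
  have "4 / (graph_diam X b * vol X m) = ennreal (4 / (D * V))"
    using pos D V by (simp add: ennreal_mult'[symmetric] divide_ennreal[symmetric])
  also have "\<dots> \<le> ennreal E"
    using main pos by (intro ennreal_leI) (simp add: pos_divide_le_eq mult_ac)
  finally show "4 / (graph_diam X b * vol X m) \<le> energy X b f" using E(1) by simp
qed

end
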